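(* Let $S$ be a quasiregular pseudocompact topological semigroup which is algebraically a primitive inverse semigroup, $S=\sum_{i\in\mathscr I}B_{\lambda_i}(G_i)$. Then the family of all sets $S\setminus\big((G_{i_1})_{\alpha_1,\beta_1}\cup\dots\cup(G_{i_k})_{\alpha_k,\beta_k}\big)$, where $k\in\mathbb N$, $i_1,\dots,i_k\in\mathscr I$ and $\alpha_j,\beta_j\in\lambda_{i_j}$, is a base of the topology of $S$ at zero.
   Context: All spaces are Hausdorff; a topological semigroup is a Hausdorff space with jointly continuous associative operation. A space $X$ is quasiregular if every non-empty open $U$ contains a non-empty open $V$ with $\operatorname{cl}_X V\subseteq U$; pseudocompact: every locally finite family of non-empty open sets is finite. For a group $G$ and cardinal $\lambda\ge1$, $B_\lambda(G)=(\lambda\times G\times\lambda)\cup\{0\}$ with $(\alpha,a,\beta)(\gamma,b,\delta)=(\alpha,ab,\delta)$ if $\beta=\gamma$ and $0$ otherwise. The orthogonal sum of semigroups $T_\iota$ with zeros is $\{0\}\cup\bigcup_\iota(T_\iota\setminus\{0_\iota\})$ with products computed in $T_\iota$ when both factors lie in the same $T_\iota$ and the product is non-zero, and $0$ otherwise. Primitive inverse semigroups are exactly orthogonal sums $\sum_{i\in\mathscr I}B_{\lambda_i}(G_i)$; we identify $B_{\lambda_i}(G_i)$ with a subsemigroup of $S$ and write $(G_i)_{\alpha,\beta}=\{(\alpha,g,\beta):g\in G_i\}$. *)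

theory Defs
  imports "HOL-Analysis.Analysis" "HOL-Algebra.Group"
begin

definition topological_semigroup :: "('a::{t2_space,semigroup_mult}) itself \<Rightarrow> bool" where
  "topological_semigroup _ \<longleftrightarrow> continuous_on UNIV (\<lambda>p::'a \<times> 'a. fst p * snd p)"

definition quasiregular :: "('a::topological_space) itself \<Rightarrow> bool" where
  "quasiregular _ \<longleftrightarrow>
     (\<forall>U::'a set. open U \<and> U \<noteq> {} \<longrightarrow> (\<exists>V. open V \<and> V \<noteq> {} \<and> closure V \<subseteq> U))"

definition locally_finite_family :: "('a::topological_space) set set \<Rightarrow> bool" where
  "locally_finite_family \<F> \<longleftrightarrow>
     (\<forall>x. \<exists>W. open W \<and> x \<in> W \<and> finite {A \<in> \<F>. A \<inter> W \<noteq> {}})"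

definition pseudocompact :: "('a::topological_space) itself \<Rightarrow> bool" where
  "pseudocompact _ \<longleftrightarrow>
     (\<forall>\<F>::'a set set. (\<forall>A\<in>\<F>. open A \<and> A \<noteq> {}) \<and> locally_finite_family \<F> \<longrightarrow> finite \<F>)"

definition is_zero :: "'a::semigroup_mult \<Rightarrow> bool" where
  "is_zero z \<longleftrightarrow> (\<forall>x. z * x = z \<and> x * z = z)"

text \<open>The semigroup (whole type 'a) with zero z is algebraically isomorphic, via phi, to the
orthogonal sum of the Brandt semigroups B_{Lam i}(G i), i in I: phi i a g b is the image
of the element (a,g,b) of B_{Lam i}(G i); each Lam i is a nonempty index set (the cardinal
lambda_i >= 1) and each G i is a group.\<close>
definition primitive_inverse_decomp ::
  "'a::semigroup_mult \<Rightarrow> 'i set \<Rightarrow> ('i \<Rightarrow> 'l set) \<Rightarrow> ('i \<Rightarrow> ('g, 'm) monoid_scheme)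
     \<Rightarrow> ('i \<Rightarrow> 'l \<Rightarrow> 'g \<Rightarrow> 'l \<Rightarrow> 'a) \<Rightarrow> bool" where
  "primitive_inverse_decomp z I Lam G phi \<longleftrightarrow>
     is_zero z \<and>
     (\<forall>i\<in>I. group (G i) \<and> Lam i \<noteq> {}) \<and>
     (\<forall>i\<in>I. \<forall>a\<in>Lam i. \<forall>g\<in>carrier (G i). \<forall>b\<in>Lam i. phi i a g b \<noteq> z) \<and>
     (\<forall>i\<in>I. \<forall>a\<in>Lam i. \<forall>g\<in>carrier (G i). \<forall>b\<in>Lam i.
        \<forall>j\<in>I. \<forall>c\<in>Lam j. \<forall>h\<in>carrier (G j). \<forall>d\<in>Lam j.
          phi i a g b = phi j c h d \<longrightarrow> i = j \<and> a = c \<and> g = h \<and> b = d) \<and>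
     (\<forall>x. x \<noteq> z \<longrightarrow> (\<exists>i\<in>I. \<exists>a\<in>Lam i. \<exists>g\<in>carrier (G i). \<exists>b\<in>Lam i. x = phi i a g b)) \<and>
     (\<forall>i\<in>I. \<forall>a\<in>Lam i. \<forall>g\<in>carrier (G i). \<forall>b\<in>Lam i.
        \<forall>j\<in>I. \<forall>c\<in>Lam j. \<forall>h\<in>carrier (G j). \<forall>d\<in>Lam j.
          phi i a g b * phi j c h d =
            (if i = j \<and> b = c then phi i a (g \<otimes>\<^bsub>G i\<^esub> h) d else z))"

definition block :: "('i \<Rightarrow> ('g, 'm) monoid_scheme) \<Rightarrow> ('i \<Rightarrow> 'l \<Rightarrow> 'g \<Rightarrow> 'l \<Rightarrow> 'a)
     \<Rightarrow> 'i \<Rightarrow> 'l \<Rightarrow> 'l \<Rightarrow> 'a set" where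
  "block G phi i a b = {phi i a g b | g. g \<in> carrier (G i)}"

definition base_at :: "('a::topological_space) set set \<Rightarrow> 'a \<Rightarrow> bool" where
  "base_at \<B> x \<longleftrightarrow> (\<forall>B\<in>\<B>. open B \<and> x \<in> B) \<and>
     (\<forall>U. open U \<and> x \<in> U \<longrightarrow> (\<exists>B\<in>\<B>. B \<subseteq> U))"

end

theory Submission
  imports Defs
begin

text \<open>
A block \<open>(G\<^sub>i)\<^sub>a\<^sub>b\<close> is the set of \<open>x\<close> with \<open>(a,1,a) x (b,1,b) \<noteq> 0\<close>, hence open, and it is closed
together with zero. In a maximal subgroup \<open>H\<close> inversion need not be known to be continuous, but
pseudocompactness shows that every neighbourhood \<open>U\<close> of the identity contains the inverses of another
one up to closure. If zero were in the closure of \<open>H\<close>, elements \<open>y\<^sub>n \<in> H\<close> could be chosen so near to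
zero that all \<open>y\<^sub>n\<close> and all \<open>y\<^sub>n y\<^sub>m\<^sup>-\<^sup>1\<close> with \<open>m < n\<close> are small; then the open sets \<open>y\<^sub>n\<^sup>-\<^sup>1 V\<close> have a
cluster point neither at zero nor in \<open>H\<close>. So all blocks are clopen.

For an open \<open>W\<close> around zero the sets \<open>(G\<^sub>i)\<^sub>a\<^sub>b - closure W\<close> form a locally finite family, so \<open>W\<close> is
dense in all but finitely many blocks. By quasiregularity two dense open subsets of \<open>(G\<^sub>i)\<^sub>a\<^sub>c\<close> and
\<open>(G\<^sub>i)\<^sub>c\<^sub>b\<close> have the whole of \<open>(G\<^sub>i)\<^sub>a\<^sub>b\<close> as their product. If \<open>W W \<subseteq> U\<close>, a block not contained in
\<open>U\<close> therefore has, for every \<open>c\<close>, one of these two factors among the finitely many exceptions; this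
leaves finitely many \<open>i\<close>, \<open>a\<close> and \<open>b\<close>.
\<close>

section \<open>Products, closures and cluster points in topological semigroups\<close>

lemma topological_semigroup_continuous:
  fixes f g :: "'b::topological_space \<Rightarrow> 'a::{t2_space,semigroup_mult}"
  assumes "topological_semigroup TYPE('a)" "continuous_on S f" "continuous_on S g"
  shows "continuous_on S (\<lambda>x. f x * g x)"
proof -
  have "continuous_on S (\<lambda>x. (\<lambda>p::'a \<times> 'a. fst p * snd p) (f x, g x))"
    by (rule continuous_on_compose2[of UNIV])
       (use assms in \<open>auto simp: topological_semigroup_def intro!: continuous_intros\<close>)
  thus ?thesis by simp
qed

lemma topological_semigroup_nhds:
  fixes x y :: "'a::{t2_space,semigroup_mult}"
  assumes "topological_semigroup TYPE('a)" "open U" "x * y \<in> U"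
  obtains A B where "open A" "open B" "x \<in> A" "y \<in> B" "\<And>a b. a \<in> A \<Longrightarrow> b \<in> B \<Longrightarrow> a * b \<in> U"
proof -
  have "open ((\<lambda>p::'a \<times> 'a. fst p * snd p) -` U)"
    using assms by (auto simp: topological_semigroup_def intro: open_vimage)
  moreover have "(x, y) \<in> (\<lambda>p::'a \<times> 'a. fst p * snd p) -` U" using assms by simp
  ultimately obtain A B where "open A" "open B" "(x, y) \<in> A \<times> B"
    "A \<times> B \<subseteq> (\<lambda>p::'a \<times> 'a. fst p * snd p) -` U"
    by (rule open_prod_elim)
  thus ?thesis using that[of A B] by fastforce
qed

lemma topological_semigroup_square_nhd:
  fixes x :: "'a::{t2_space,semigroup_mult}"
  assumes "topological_semigroup TYPE('a)" "open U" "x * x \<in> U"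
  obtains A where "open A" "x \<in> A" "\<And>a b. a \<in> A \<Longrightarrow> b \<in> A \<Longrightarrow> a * b \<in> U"
proof -
  obtain A B where "open A" "open B" "x \<in> A" "x \<in> B" "\<And>a b. a \<in> A \<Longrightarrow> b \<in> B \<Longrightarrow> a * b \<in> U"
    using topological_semigroup_nhds[OF assms] by blast
  thus ?thesis using that[of "A \<inter> B"] by blast
qed

lemma topological_semigroup_mult_closure:
  fixes x y :: "'a::{t2_space,semigroup_mult}"
  assumes "topological_semigroup TYPE('a)" "x \<in> closure A" "y \<in> closure B"
    and C: "\<And>a b. a \<in> A \<Longrightarrow> b \<in> B \<Longrightarrow> a * b \<in> C"
  shows "x * y \<in> closure C"
proof -
  have "(\<lambda>p::'a \<times> 'a. fst p * snd p) ` closure (A \<times> B) \<subseteq> closure C"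
    by (rule image_closure_subset)
       (use assms closure_subset[of C] in \<open>auto simp: topological_semigroup_def
          intro: continuous_on_subset\<close>)
  thus ?thesis using assms(2,3) by (fastforce simp: closure_Times)
qed

lemma open_disjoint_closure:
  "open V \<Longrightarrow> x \<in> V \<Longrightarrow> V \<inter> A = {} \<Longrightarrow> x \<notin> closure A"
  using open_Int_closure_eq_empty by blast

text \<open>Pseudocompactness concerns a set of sets, so repetitions are treated apart: if
  \<open>range D\<close> is finite, some member recurs infinitely often and any of its points
  serves; otherwise local finiteness fails at some \<open>p\<close>.\<close>

lemma pseudocompact_cluster_point:
  fixes D :: "nat \<Rightarrow> 'a::topological_space set"
  assumes "pseudocompact TYPE('a)" "\<And>n. open (D n)" "\<And>n. D n \<noteq> {}"
  shows "\<exists>p. \<forall>N. open N \<longrightarrow> p \<in> N \<longrightarrow> (\<exists>\<^sub>\<infinity>n. D n \<inter> N \<noteq> {})"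
proof (cases "finite (range D)")
  case True
  then obtain k where k: "infinite {n. D n = D k}"
    using pigeonhole_infinite[of UNIV D] by auto
  obtain p where p: "p \<in> D k" using assms(3) by blast
  have "\<exists>\<^sub>\<infinity>n. D n \<inter> N \<noteq> {}" if "p \<in> N" for N
  proof -
    have "{n. D n = D k} \<subseteq> {n. D n \<inter> N \<noteq> {}}" using p that by auto
    thus ?thesis using k unfolding frequently_cofinite by (meson finite_subset)
  qed
  thus ?thesis by blast
next
  case False
  have "(\<forall>A\<in>range D. open A \<and> A \<noteq> {}) \<and> locally_finite_family (range D) \<longrightarrow> finite (range D)"
    using assms(1) unfolding pseudocompact_def by (rule spec)
  hence "\<not> locally_finite_family (range D)"
    using False assms(2,3) by auto
  then obtain p where p: "\<forall>W. open W \<and> p \<in> W \<longrightarrow> infinite {A \<in> range D. A \<inter> W \<noteq> {}}"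
    unfolding locally_finite_family_def by blast
  have "\<exists>\<^sub>\<infinity>n. D n \<inter> N \<noteq> {}" if "open N" "p \<in> N" for N
  proof -
    have eq: "{A \<in> range D. A \<inter> N \<noteq> {}} = D ` {n. D n \<inter> N \<noteq> {}}" by auto
    have "infinite {A \<in> range D. A \<inter> N \<noteq> {}}" using p that by simp
    hence "infinite (D ` {n. D n \<inter> N \<noteq> {}})" unfolding eq .
    thus ?thesis unfolding frequently_cofinite by (blast dest: finite_imageI)
  qed
  thus ?thesis by blast
qed

section \<open>Open subgroups that are closed together with zero\<close>

locale pseudocompact_group_with_zero =
  fixes H :: "'a::{t2_space,semigroup_mult} set" and z e :: 'a and \<nu> :: "'a \<Rightarrow> 'a"
  assumes semigroup: "topological_semigroup TYPE('a)"
    and pseudocompact: "pseudocompact TYPE('a)"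
    and open_H: "open H" and closed_H0: "closed (insert z H)"
    and zero: "is_zero z" and z_notin: "z \<notin> H"
    and e_in [simp]: "e \<in> H"
    and mult_in [simp]: "x \<in> H \<Longrightarrow> y \<in> H \<Longrightarrow> x * y \<in> H"
    and e_left [simp]: "x \<in> H \<Longrightarrow> e * x = x"
    and e_right [simp]: "x \<in> H \<Longrightarrow> x * e = x"
    and inv_in [simp]: "x \<in> H \<Longrightarrow> \<nu> x \<in> H"
    and inv_left [simp]: "x \<in> H \<Longrightarrow> \<nu> x * x = e"
    and inv_right [simp]: "x \<in> H \<Longrightarrow> x * \<nu> x = e"
begin

lemma inv_cancel [simp]:
  assumes "x \<in> H" "y \<in> H"
  shows "\<nu> x * (x * y) = y" "x * (\<nu> x * y) = y" "y * x * \<nu> x = y" "y * \<nu> x * x = y"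
proof -
  show "\<nu> x * (x * y) = y" "x * (\<nu> x * y) = y"
    using assms by (simp_all flip: mult.assoc)
  show "y * x * \<nu> x = y" "y * \<nu> x * x = y"
    using assms by (simp_all add: mult.assoc)
qed

lemma inv_unique: "x \<in> H \<Longrightarrow> y \<in> H \<Longrightarrow> x * y = e \<Longrightarrow> \<nu> x = y"
  by (metis inv_cancel(1) e_right inv_in)

lemma inv_mult: "x \<in> H \<Longrightarrow> y \<in> H \<Longrightarrow> \<nu> (x * y) = \<nu> y * \<nu> x"
  by (rule inv_unique) (simp_all add: mult.assoc)

lemma open_left_vimage: "open V \<Longrightarrow> open {x \<in> H. t * x \<in> V}"
proof -
  assume "open V"
  hence "open ((\<lambda>x. t * x) -` V)"
    by (intro open_vimage topological_semigroup_continuous semigroup continuous_intros)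
  moreover have "{x \<in> H. t * x \<in> V} = H \<inter> (\<lambda>x. t * x) -` V" by auto
  ultimately show ?thesis using open_H by auto
qed

lemma open_right_vimage: "open V \<Longrightarrow> open {x \<in> H. x * t \<in> V}"
proof -
  assume "open V"
  hence "open ((\<lambda>x. x * t) -` V)"
    by (intro open_vimage topological_semigroup_continuous semigroup continuous_intros)
  moreover have "{x \<in> H. x * t \<in> V} = H \<inter> (\<lambda>x. x * t) -` V" by auto
  ultimately show ?thesis using open_H by auto
qed

lemma cluster_point:
  assumes D: "\<And>n::nat. open (D n)" "\<And>n. D n \<noteq> {}" "\<And>n. D n \<subseteq> H"
  shows "\<exists>p\<in>insert z H. \<forall>N. open N \<longrightarrow> p \<in> N \<longrightarrow> (\<exists>\<^sub>\<infinity>n. D n \<inter> N \<noteq> {})"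
proof -
  obtain p where p: "\<forall>N. open N \<longrightarrow> p \<in> N \<longrightarrow> (\<exists>\<^sub>\<infinity>n. D n \<inter> N \<noteq> {})"
    using pseudocompact_cluster_point[of D, OF pseudocompact D(1,2)] by (elim exE) (rule that)
  have "p \<in> insert z H"
  proof (rule ccontr)
    assume "p \<notin> insert z H"
    hence "\<exists>\<^sub>\<infinity>n. D n \<inter> - insert z H \<noteq> {}"
      using p[rule_format, of "- insert z H"] closed_H0 by auto
    then obtain n where "D n \<inter> - insert z H \<noteq> {}" by (blast dest: frequently_ex)
    thus False using D(3) by blast
  qed
  with p show ?thesis by (rule bexI)
qed

text \<open>A substitute for continuity of inversion at \<open>e\<close>. If it failed, right
  multiplication by offending points would yield \<open>t n\<close> with every
  \<open>\<nu> (t (Suc n)) * t n\<close> outside \<open>closure U\<close>; a cluster point of open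
  sets around the \<open>t n\<close> contradicts this.\<close>

lemma weak_inverse_continuity:
  assumes U: "open U" "e \<in> U"
  obtains V where "open V" "e \<in> V" "V \<subseteq> H" "\<And>x. x \<in> V \<Longrightarrow> \<nu> x \<in> closure U"
proof (rule ccontr)
  note choice = that
  assume "\<not> thesis"
  hence no: "\<exists>x\<in>V. \<nu> x \<notin> closure U" if "open V" "e \<in> V" "V \<subseteq> H" for V
    using choice that by blast
  \<comment> \<open>Keeping every \<open>E n\<close> inside \<open>W0\<close> will prevent the
    cluster point from being \<open>z\<close>.\<close>
  obtain Z W0 where W0: "open Z" "open W0" "z \<in> Z" "e \<in> W0" "Z \<inter> W0 = {}"
    using hausdorff[of z e] z_notin e_in by metis
  have "e * e \<in> U" using U by simp
  from topological_semigroup_square_nhd[OF semigroup U(1) this]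
  obtain W where W: "open W" "e \<in> W" "\<And>a b. a \<in> W \<Longrightarrow> b \<in> W \<Longrightarrow> a * b \<in> U" by blast
  define P where "P = (\<lambda>(E, t). open E \<and> t \<in> E \<and> E \<subseteq> H \<and> E \<subseteq> W0 \<and> (\<forall>y\<in>E. \<nu> t * y \<in> W))"
  define R where "R = (\<lambda>(E::'a set, t) (E', t'). E' \<subseteq> E \<and> \<nu> t' * t \<notin> closure U)"
  \<comment> \<open>\<open>E\<^sub>n \<subseteq> t\<^sub>n W\<close> is decreasing, and \<open>E\<^sub>n\<close> without \<open>t\<^sub>n\<^sub>+\<^sub>1 closure U\<close> still contains \<open>t\<^sub>n\<close>. These open
    sets cluster at some \<open>p\<close> in every \<open>closure E\<^sub>m\<close>, so \<open>p W\<close> must miss the \<open>n\<close>-th of them.\<close>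
  have "\<exists>f. \<forall>n::nat. P (f n) \<and> R (f n) (f (Suc n))"
  proof (rule dependent_nat_choice)
    have "\<nu> e = e" by (rule inv_unique) simp_all
    hence "P (H \<inter> W \<inter> W0, e)"
      unfolding P_def using W0 W open_H by auto
    thus "\<exists>x. P x" ..
  next
    fix s :: "'a set \<times> 'a" and n :: nat
    assume "P s"
    obtain E t where s: "s = (E, t)" by fastforce
    have E: "open E" "t \<in> E" "E \<subseteq> H" "E \<subseteq> W0" using \<open>P s\<close> by (auto simp: P_def s)
    hence t: "t \<in> H" by auto
    \<comment> \<open>The next point is \<open>t * x\<close>; cancellation turns
      \<open>\<nu> (t * x) * t\<close> into \<open>\<nu> x\<close>, which is outside
      \<open>closure U\<close>.\<close>
    obtain x where x: "x \<in> H" "t * x \<in> E" "\<nu> x \<notin> closure U"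
      using no[of "{x \<in> H. t * x \<in> E}"] open_left_vimage[OF E(1)] E(2) t by auto
    have "P (E \<inter> {y \<in> H. \<nu> (t * x) * y \<in> W}, t * x)"
      unfolding P_def using E x t W open_left_vimage[OF W(1)] by auto
    moreover have "R s (E \<inter> {y \<in> H. \<nu> (t * x) * y \<in> W}, t * x)"
      unfolding R_def s using x t by (simp add: inv_mult)
    ultimately show "\<exists>y. P y \<and> R s y" by blast
  qed
  then obtain f where f: "\<And>n::nat. P (f n) \<and> R (f n) (f (Suc n))" by blast
  define E where "E n = fst (f n)" for n
  define t where "t n = snd (f n)" for n
  have E: "open (E n)" "t n \<in> E n" "E n \<subseteq> H" "E n \<subseteq> W0" "\<And>y. y \<in> E n \<Longrightarrow> \<nu> (t n) * y \<in> W"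
    "E (Suc n) \<subseteq> E n" "\<nu> (t (Suc n)) * t n \<notin> closure U" for n
    using f[of n] by (auto simp: P_def R_def E_def t_def split: prod.splits)
  have tH: "t n \<in> H" for n using E(2,3) by blast
  have dec: "m \<le> n \<Longrightarrow> E n \<subseteq> E m" for m n
    using E(6) by (rule lift_Suc_antimono_le)
  define D where "D n = E n \<inter> {y \<in> H. \<nu> (t (Suc n)) * y \<in> - closure U}" for n
  have D: "open (D n)" "D n \<noteq> {}" "D n \<subseteq> H" for n
  proof -
    show "open (D n)" unfolding D_def
      by (intro open_Int E(1) open_left_vimage) auto
    have "t n \<in> D n" unfolding D_def using E(2,7) tH by auto
    thus "D n \<noteq> {}" by auto
  qed (auto simp: D_def)
  obtain p where "p \<in> insert z H" "\<forall>N. open N \<longrightarrow> p \<in> N \<longrightarrow> (\<exists>\<^sub>\<infinity>n. D n \<inter> N \<noteq> {})"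
    using cluster_point[of D, OF D] by (elim bexE) (rule that)
  note p = this(1) this(2)[rule_format]
  have pE: "p \<in> closure (E m)" for m
  proof (rule ccontr)
    assume "p \<notin> closure (E m)"
    hence "\<exists>\<^sub>\<infinity>n. D n \<inter> - closure (E m) \<noteq> {}" using p(2)[of "- closure (E m)"] by auto
    then obtain n where "n \<ge> m" "D n \<inter> - closure (E m) \<noteq> {}"
      unfolding INFM_nat_le by blast
    thus False using dec[of m n] closure_subset[of "E m"] unfolding D_def by blast
  qed
  have "z \<notin> closure (E 0)"
    using W0 E(4)[of 0] by (intro open_disjoint_closure[of Z]) auto
  hence pH: "p \<in> H" using p(1) pE[of 0] by auto
  have "\<exists>\<^sub>\<infinity>n. D n \<inter> {y \<in> H. \<nu> p * y \<in> W} \<noteq> {}"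
    by (rule p(2)) (use pH W open_left_vimage in auto)
  then obtain n d where d: "d \<in> D n" "d \<in> H" "\<nu> p * d \<in> W"
    by (auto dest!: frequently_ex)
  \<comment> \<open>The index is the one that defines \<open>D n\<close>. As
    \<open>E (Suc n)\<close> lies in \<open>t (Suc n) W\<close> and \<open>d\<close> in
    \<open>p W\<close>, the factor \<open>p\<close> cancels and \<open>\<nu> (t (Suc n)) * d\<close>
    falls into \<open>closure U\<close>.\<close>
  have "\<nu> (t (Suc n)) * p \<in> closure W"
    by (rule topological_semigroup_mult_closure[OF semigroup _ pE[of "Suc n"], of _ "{\<nu> (t (Suc n))}"])
       (use E(5) in auto)
  moreover have "\<nu> p * d \<in> closure W" using d(3) closure_subset by blast
  ultimately have "\<nu> (t (Suc n)) * p * (\<nu> p * d) \<in> closure U"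
    by (rule topological_semigroup_mult_closure[OF semigroup]) (use W in auto)
  moreover have "\<nu> (t (Suc n)) * p * (\<nu> p * d) = \<nu> (t (Suc n)) * d"
    using pH d(2) by (simp add: mult.assoc)
  ultimately show False using d(1) unfolding D_def by auto
qed

text \<open>Otherwise \<open>H\<close> contains \<open>y n\<close> such that \<open>y n\<close> and
  all \<open>y n * \<nu> (y m)\<close> with \<open>m < n\<close> are near zero. For \<open>x\<close>
  in \<open>D m\<close> and \<open>x'\<close> in \<open>D n\<close> near a common cluster point,
  \<open>y n * x' = (y n * \<nu> (y m)) * (y m * x) * (\<nu> x * x')\<close>; the right side is near
  zero, the left side lies in \<open>V\<close>, near \<open>e\<close>.\<close>

lemma zero_notin_closure: "z \<notin> closure H"
proof
  assume zcl: "z \<in> closure H"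
  have zm [simp]: "z * x = z" "x * z = z" for x using zero by (auto simp: is_zero_def)
  \<comment> \<open>The neighbourhoods are chosen backwards from the final product:
    \<open>O2 V2\<close> in \<open>O1\<close>, \<open>O1 N'\<close> in \<open>O0\<close>, and
    \<open>O0\<close> misses \<open>V0\<close>. \<open>O3\<close> serves to exclude \<open>z\<close>
    as cluster point.\<close>
  obtain O0 V0 where V0: "open O0" "open V0" "z \<in> O0" "e \<in> V0" "O0 \<inter> V0 = {}"
    using hausdorff[of z e] z_notin e_in by metis
  have "z * e \<in> O0" using V0 by simp
  from topological_semigroup_nhds[OF semigroup V0(1) this]
  obtain O1 N' where O1: "open O1" "open N'" "z \<in> O1" "e \<in> N'"
    "\<And>a b. a \<in> O1 \<Longrightarrow> b \<in> N' \<Longrightarrow> a * b \<in> O0" by blast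
  have "z * e \<in> O1" using O1 by simp
  from topological_semigroup_nhds[OF semigroup O1(1) this]
  obtain O2 V2 where O2: "open O2" "open V2" "z \<in> O2" "e \<in> V2"
    "\<And>a b. a \<in> O2 \<Longrightarrow> b \<in> V2 \<Longrightarrow> a * b \<in> O1" by blast
  have "z * z \<in> O0" using V0 by simp
  from topological_semigroup_square_nhd[OF semigroup V0(1) this]
  obtain O3 where O3: "open O3" "z \<in> O3" "\<And>a b. a \<in> O3 \<Longrightarrow> b \<in> O3 \<Longrightarrow> a * b \<in> O0" by blast
  define Q where "Q = O2 \<inter> O3"
  have Q: "open Q" "z \<in> Q" using O2 O3 by (auto simp: Q_def)
  define V where "V = V0 \<inter> V2 \<inter> H"
  have V: "open V" "e \<in> V" "V \<subseteq> H" using V0 O2 open_H by (auto simp: V_def)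
  \<comment> \<open>\<open>\<nu> x * x'\<close> will be written as
    \<open>\<nu> (\<nu> p * x) * (\<nu> p * x')\<close>; its first factor is controlled only up to
    closure, so the product lands in \<open>closure N'\<close>.\<close>
  have "e * e \<in> N'" using O1 by simp
  from topological_semigroup_square_nhd[OF semigroup O1(2) this]
  obtain M where M: "open M" "e \<in> M" "\<And>a b. a \<in> M \<Longrightarrow> b \<in> M \<Longrightarrow> a * b \<in> N'" by blast
  obtain N where N: "open N" "e \<in> N" "N \<subseteq> H" "\<And>x. x \<in> N \<Longrightarrow> \<nu> x \<in> closure M"
    using weak_inverse_continuity[OF M(1,2)] by blast
  define P where "P = (\<lambda>(y, X). y \<in> H \<and> y \<in> Q \<and> open X \<and> z \<in> X \<and> X \<subseteq> Q \<and> (\<forall>u\<in>X. u * \<nu> y \<in> Q))"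
  \<comment> \<open>\<open>X\<^sub>n\<close> is the neighbourhood of zero to which all later \<open>y\<close> are confined.\<close>
  define R where "R = (\<lambda>(y::'a, X::'a set) (y', X'). y' \<in> X \<and> X' \<subseteq> X)"
  have ex: "\<exists>y' X'. P (y', X') \<and> y' \<in> X \<and> X' \<subseteq> X" if X: "open X" "z \<in> X" "X \<subseteq> Q" for X
  proof -
    obtain y where y: "y \<in> H" "y \<in> X"
      using zcl X by (meson closure_iff_nhds_not_empty disjoint_iff subset_refl)
    \<comment> \<open>Multiplication by \<open>\<nu> y\<close> fixes zero, so it maps a
      neighbourhood \<open>A\<close> of zero into \<open>Q\<close>; later choices within
      \<open>A\<close> have small quotients by \<open>y\<close>.\<close>
    have "z * \<nu> y \<in> Q" using Q by simp
    from topological_semigroup_nhds[OF semigroup Q(1) this]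
    obtain A B where A: "open A" "open B" "z \<in> A" "\<nu> y \<in> B"
      "\<And>a b. a \<in> A \<Longrightarrow> b \<in> B \<Longrightarrow> a * b \<in> Q" by blast
    have "P (y, X \<inter> A)" unfolding P_def using X y A by auto
    thus ?thesis using y by blast
  qed
  have "\<exists>f. \<forall>n::nat. P (f n) \<and> R (f n) (f (Suc n))"
  proof (rule dependent_nat_choice)
    show "\<exists>x. P x" using ex[of Q] Q by auto
  next
    fix s :: "'a \<times> 'a set" and n :: nat
    assume "P s"
    thus "\<exists>y. P y \<and> R s y" using ex[of "snd s"] by (auto simp: P_def R_def split: prod.splits)
  qed
  then obtain f where f: "\<And>n::nat. P (f n) \<and> R (f n) (f (Suc n))" by blast
  define y where "y n = fst (f n)" for n
  define X where "X n = snd (f n)" for n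
  have y: "y n \<in> H" "y n \<in> Q" "\<And>u. u \<in> X n \<Longrightarrow> u * \<nu> (y n) \<in> Q" "y (Suc n) \<in> X n"
    "X (Suc n) \<subseteq> X n" for n
    using f[of n] by (auto simp: P_def R_def y_def X_def split: prod.splits)
  have dec: "m \<le> n \<Longrightarrow> X n \<subseteq> X m" for m n
    using y(5) by (rule lift_Suc_antimono_le)
  have yy: "y n * \<nu> (y m) \<in> Q" if "m < n" for m n
  proof -
    obtain k where k: "n = Suc k" "m \<le> k" using \<open>m < n\<close> by (cases n) auto
    show ?thesis using y(3)[of "y n" m] y(4)[of k] dec[OF k(2)] k(1) by auto
  qed
  define D where "D n = {x \<in> H. y n * x \<in> V}" for n
  have D: "open (D n)" "D n \<noteq> {}" "D n \<subseteq> H" for n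
  proof -
    show "open (D n)" unfolding D_def by (rule open_left_vimage[OF V(1)])
    have "\<nu> (y n) \<in> D n" unfolding D_def using y V by auto
    thus "D n \<noteq> {}" by auto
  qed (auto simp: D_def)
  obtain p where "p \<in> insert z H" "\<forall>N. open N \<longrightarrow> p \<in> N \<longrightarrow> (\<exists>\<^sub>\<infinity>n. D n \<inter> N \<noteq> {})"
    using cluster_point[of D, OF D] by (elim bexE) (rule that)
  note p = this(1) this(2)[rule_format]
  \<comment> \<open>Otherwise some \<open>x\<close> in \<open>D n\<close> lies in \<open>Q\<close>,
    and \<open>y n * x\<close> is both in \<open>O3 O3\<close>, hence in \<open>O0\<close>, and in
    \<open>V0\<close>.\<close>
  have "p \<noteq> z"
  proof
    assume "p = z"
    then obtain n x where "x \<in> D n" "x \<in> Q" using p(2)[of Q] Q by (auto dest!: frequently_ex)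
    thus False using y(2)[of n] O3(3)[of "y n" x] V0(5) by (auto simp: D_def Q_def V_def)
  qed
  hence pH: "p \<in> H" using p(1) by auto
  have inf: "\<exists>\<^sub>\<infinity>n. D n \<inter> {x \<in> H. \<nu> p * x \<in> M \<inter> N} \<noteq> {}"
    by (rule p(2)[OF open_left_vimage]) (use pH M N in auto)
  then obtain m where "D m \<inter> {x \<in> H. \<nu> p * x \<in> M \<inter> N} \<noteq> {}" by (auto dest!: frequently_ex)
  then obtain x where x: "x \<in> D m" "x \<in> H" "\<nu> p * x \<in> N" by auto
  obtain n where n: "m < n" "D n \<inter> {x \<in> H. \<nu> p * x \<in> M \<inter> N} \<noteq> {}"
    using inf unfolding INFM_nat by blast
  then obtain x' where x': "x' \<in> D n" "x' \<in> H" "\<nu> p * x' \<in> M" by auto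
  have "\<nu> (\<nu> p * x) * (\<nu> p * x') \<in> closure N'"
    by (rule topological_semigroup_mult_closure[OF semigroup N(4)[OF x(3)]])
       (use M x'(3) closure_subset[of M] in auto)
  hence c: "\<nu> x * x' \<in> closure N'"
    using x x' pH by (simp add: inv_mult mult.assoc)
  have "(y n * \<nu> (y m)) * (y m * x) \<in> O1"
    using yy[OF n(1)] x(1) O2(5) by (auto simp: D_def V_def Q_def)
  hence "(y n * \<nu> (y m)) * (y m * x) \<in> closure O1" using closure_subset by blast
  hence "(y n * \<nu> (y m)) * (y m * x) * (\<nu> x * x') \<in> closure O0"
    by (rule topological_semigroup_mult_closure[OF semigroup _ c O1(5)])
  hence "y n * x' \<in> closure O0"
    using x x' y(1) by (simp add: mult.assoc)
  moreover have "y n * x' \<notin> closure O0"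
    using x' V0 by (intro open_disjoint_closure[of V0]) (auto simp: D_def V_def)
  ultimately show False by blast
qed

text \<open>Quasiregularity absorbs the closure in \<open>weak_inverse_continuity\<close>: for
  \<open>closure U \<subseteq> Q\<close> and \<open>u\<close> in \<open>U\<close>, some
  neighbourhood \<open>V\<close> of \<open>e\<close> has \<open>u * \<nu> x\<close> in
  \<open>Q\<close> for all \<open>x \<in> V\<close>. Hence the open set of \<open>h\<close> with
  \<open>h * u\<close> in \<open>V\<close> consists of inverses of elements of \<open>Q\<close>, and
  \<open>P\<close> meets it.\<close>

lemma dense_meets_inverse:
  assumes qr: "quasiregular TYPE('a)"
    and Q: "open Q" "Q \<noteq> {}" "Q \<subseteq> H"
    and dense: "\<And>D. open D \<Longrightarrow> D \<noteq> {} \<Longrightarrow> D \<subseteq> H \<Longrightarrow> D \<inter> P \<noteq> {}"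
  obtains h k where "h \<in> P" "k \<in> Q" "h \<in> H" "h * k = e"
proof -
  obtain U where U: "open U" "U \<noteq> {}" "closure U \<subseteq> Q"
    using qr Q unfolding quasiregular_def by blast
  then obtain u where u: "u \<in> U" by blast
  have UH: "U \<subseteq> H" using U(3) Q(3) closure_subset by blast
  have uH: "u \<in> H" using u UH by blast
  obtain V where V: "open V" "e \<in> V" "V \<subseteq> H" "\<And>x. x \<in> V \<Longrightarrow> \<nu> x \<in> closure {x \<in> H. u * x \<in> U}"
    by (rule weak_inverse_continuity[of "{x \<in> H. u * x \<in> U}"])
       (use U(1) u uH open_left_vimage in auto)
  have V': "u * \<nu> x \<in> Q" if "x \<in> V" for x
  proof -
    have "u * \<nu> x \<in> closure U"
      by (rule topological_semigroup_mult_closure[OF semigroup _ V(4)[OF that], of _ "{u}"]) auto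
    thus ?thesis using U by blast
  qed
  have "\<nu> u \<in> {x \<in> H. x * u \<in> V}" using V uH by simp
  then obtain h where h: "h \<in> H" "h * u \<in> V" "h \<in> P"
    using dense[of "{x \<in> H. x * u \<in> V}"] open_right_vimage[OF V(1)] by blast
  have "h * (u * \<nu> (h * u)) = e" using h uH by (simp add: inv_mult)
  thus ?thesis using that V'[OF h(2)] h by blast
qed

end

section \<open>Algebra of the blocks of an orthogonal sum\<close>

locale pseudocompact_primitive_semigroup =
  fixes z :: "'a::{t2_space,semigroup_mult}"
    and I :: "'i set" and Lam :: "'i \<Rightarrow> 'l set"
    and G :: "'i \<Rightarrow> ('g, 'm) monoid_scheme"
    and phi :: "'i \<Rightarrow> 'l \<Rightarrow> 'g \<Rightarrow> 'l \<Rightarrow> 'a"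
  assumes semigroup: "topological_semigroup TYPE('a)"
    and pseudocompact: "pseudocompact TYPE('a)"
    and decomp: "primitive_inverse_decomp z I Lam G phi"
begin

abbreviation B where "B \<equiv> block G phi"

abbreviation indices where "indices \<equiv> {(i, a, b). i \<in> I \<and> a \<in> Lam i \<and> b \<in> Lam i}"

definition idem where "idem i a = phi i a \<one>\<^bsub>G i\<^esub> a"

lemma zero: "is_zero z"
  using decomp by (simp add: primitive_inverse_decomp_def)

lemma zero_mult [simp]: "z * x = z" "x * z = z"
  using zero by (auto simp: is_zero_def)

lemma group: "i \<in> I \<Longrightarrow> group (G i)"
  using decomp by (simp add: primitive_inverse_decomp_def)

lemma phi_mult:
  assumes "i \<in> I" "a \<in> Lam i" "g \<in> carrier (G i)" "b \<in> Lam i"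
    "j \<in> I" "c \<in> Lam j" "h \<in> carrier (G j)" "d \<in> Lam j"
  shows "phi i a g b * phi j c h d = (if i = j \<and> b = c then phi i a (g \<otimes>\<^bsub>G i\<^esub> h) d else z)"
proof -
  have "\<forall>i\<in>I. \<forall>a\<in>Lam i. \<forall>g\<in>carrier (G i). \<forall>b\<in>Lam i.
        \<forall>j\<in>I. \<forall>c\<in>Lam j. \<forall>h\<in>carrier (G j). \<forall>d\<in>Lam j.
          phi i a g b * phi j c h d =
            (if i = j \<and> b = c then phi i a (g \<otimes>\<^bsub>G i\<^esub> h) d else z)"
    using decomp unfolding primitive_inverse_decomp_def by (elim conjE)
  from this[rule_format, OF assms] show ?thesis .
qed

lemma one_closed [simp]: "i \<in> I \<Longrightarrow> \<one>\<^bsub>G i\<^esub> \<in> carrier (G i)"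
  using group by (simp add: group.is_monoid)

lemma block_cases:
  obtains "x = z" | i a b where "i \<in> I" "a \<in> Lam i" "b \<in> Lam i" "x \<in> B i a b"
proof -
  have "x \<noteq> z \<longrightarrow> (\<exists>i\<in>I. \<exists>a\<in>Lam i. \<exists>g\<in>carrier (G i). \<exists>b\<in>Lam i. x = phi i a g b)"
    using decomp unfolding primitive_inverse_decomp_def by (elim conjE) (erule spec)
  thus ?thesis using that unfolding block_def by blast
qed

lemma zero_notin_block:
  assumes "i \<in> I" "a \<in> Lam i" "b \<in> Lam i"
  shows "z \<notin> B i a b"
proof -
  have "\<forall>i\<in>I. \<forall>a\<in>Lam i. \<forall>g\<in>carrier (G i). \<forall>b\<in>Lam i. phi i a g b \<noteq> z"
    using decomp unfolding primitive_inverse_decomp_def by (elim conjE)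
  thus ?thesis using assms unfolding block_def by blast
qed

lemma block_nonempty: "i \<in> I \<Longrightarrow> B i a b \<noteq> {}"
  using one_closed unfolding block_def by blast

lemma block_unique:
  assumes "(i, a, b) \<in> indices" "(j, c, d) \<in> indices" "x \<in> B i a b" "x \<in> B j c d"
  shows "(i, a, b) = (j, c, d)"
proof -
  have "\<forall>i\<in>I. \<forall>a\<in>Lam i. \<forall>g\<in>carrier (G i). \<forall>b\<in>Lam i.
        \<forall>j\<in>I. \<forall>c\<in>Lam j. \<forall>h\<in>carrier (G j). \<forall>d\<in>Lam j.
          phi i a g b = phi j c h d \<longrightarrow> i = j \<and> a = c \<and> g = h \<and> b = d"
    using decomp unfolding primitive_inverse_decomp_def by (elim conjE)
  thus ?thesis using assms unfolding block_def by blast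
qed

lemma idem_in_block: "i \<in> I \<Longrightarrow> idem i a \<in> B i a a"
  using one_closed unfolding block_def idem_def by blast

lemma mult_in_block:
  assumes "i \<in> I" "a \<in> Lam i" "b \<in> Lam i" "c \<in> Lam i" "x \<in> B i a b" "y \<in> B i b c"
  shows "x * y \<in> B i a c"
proof -
  obtain g h where "g \<in> carrier (G i)" "x = phi i a g b" "h \<in> carrier (G i)" "y = phi i b h c"
    using assms unfolding block_def by blast
  moreover have "g \<otimes>\<^bsub>G i\<^esub> h \<in> carrier (G i)"
    using group[OF assms(1)] calculation by (simp add: group.is_monoid monoid.m_closed)
  ultimately show ?thesis using assms unfolding block_def by (auto simp: phi_mult)
qed

lemma mult_distinct_blocks:
  assumes "(i, a, b) \<in> indices" "(j, c, d) \<in> indices" "x \<in> B i a b" "y \<in> B j c d" "(i, b) \<noteq> (j, c)"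
  shows "x * y = z"
  using assms unfolding block_def by (auto simp: phi_mult)

lemma idem_mult [simp]:
  assumes "i \<in> I" "a \<in> Lam i" "b \<in> Lam i" "x \<in> B i a b"
  shows "idem i a * x = x" "x * idem i b = x"
  using assms group[OF assms(1)] unfolding block_def idem_def
  by (auto simp: phi_mult group.is_monoid monoid.l_one monoid.r_one)

lemma block_inverse:
  assumes "i \<in> I" "a \<in> Lam i" "b \<in> Lam i" "x \<in> B i a b"
  obtains y where "y \<in> B i b a" "x * y = idem i a" "y * x = idem i b"
proof -
  obtain g where g: "g \<in> carrier (G i)" "x = phi i a g b"
    using assms unfolding block_def by blast
  let ?y = "phi i b (inv\<^bsub>G i\<^esub> g) a"
  have "inv\<^bsub>G i\<^esub> g \<in> carrier (G i)" using group[OF assms(1)] g by simp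
  moreover from this have "x * ?y = idem i a" "?y * x = idem i b"
    using assms g group[OF assms(1)] unfolding idem_def
    by (auto simp: phi_mult group.r_inv group.l_inv)
  ultimately show ?thesis using that[of ?y] unfolding block_def by blast
qed

text \<open>For a nonzero \<open>x\<close> outside the block, one of the two idempotents meets a
  wrong index and gives zero. This continuous map detects the block topologically.\<close>

lemma sandwich:
  assumes "(i, a, b) \<in> indices"
  shows "idem i a * x * idem i b = (if x \<in> B i a b then x else z)"
proof (cases x rule: block_cases)
  case 1
  thus ?thesis by simp
next
  case (2 j c d)
  show ?thesis
  proof (cases "x \<in> B i a b")
    case True
    thus ?thesis using assms idem_mult[of i a b x] by simp
  next
    case False
    hence ne: "(i, a) \<noteq> (j, c) \<or> (j, d) \<noteq> (i, b)" using 2 by auto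
    have 1: "idem i a \<in> B i a a" "idem i b \<in> B i b b" using assms idem_in_block by auto
    show ?thesis using ne
    proof
      assume "(i, a) \<noteq> (j, c)"
      hence "idem i a * x = z"
        using mult_distinct_blocks[of i a a j c d] 1 2 assms by auto
      thus ?thesis using False by simp
    next
      assume "(j, d) \<noteq> (i, b)"
      hence "x * idem i b = z"
        using mult_distinct_blocks[of j c d i b b] 1 2 assms by auto
      thus ?thesis using False by (simp add: mult.assoc)
    qed
  qed
qed

section \<open>Blocks are open and closed\<close>

lemma open_block:
  assumes "(i, a, b) \<in> indices"
  shows "open (B i a b)"
proof -
  have "B i a b = (\<lambda>x. idem i a * x * idem i b) -` (- {z})"
    using sandwich[OF assms] zero_notin_block assms by (auto split: if_splits)
  thus ?thesis
    by (auto intro!: open_vimage topological_semigroup_continuous semigroup continuous_intros)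
qed

text \<open>The fixed points of the \<open>sandwich\<close> map form a closed set, as the space is
  Hausdorff.\<close>

lemma closed_insert_zero_block:
  assumes "(i, a, b) \<in> indices"
  shows "closed (insert z (B i a b))"
proof -
  have "insert z (B i a b) = {x. idem i a * x * idem i b = x}"
    using sandwich[OF assms] by auto
  thus ?thesis
    by (auto intro!: closed_Collect_eq topological_semigroup_continuous semigroup continuous_intros)
qed

lemma maximal_subgroup:
  assumes "i \<in> I" "a \<in> Lam i"
  obtains \<nu> where "pseudocompact_group_with_zero (B i a a) z (idem i a) \<nu>"
proof -
  have "\<forall>x\<in>B i a a. \<exists>y\<in>B i a a. x * y = idem i a \<and> y * x = idem i a"
    using block_inverse[OF assms assms(2)] by metis
  then obtain \<nu> where "\<forall>x\<in>B i a a. \<nu> x \<in> B i a a \<and> x * \<nu> x = idem i a \<and> \<nu> x * x = idem i a"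
    by metis
  hence "pseudocompact_group_with_zero (B i a a) z (idem i a) \<nu>"
    using assms
    by unfold_locales
       (auto simp: semigroup pseudocompact zero zero_notin_block idem_in_block
          intro: open_block closed_insert_zero_block mult_in_block)
  thus ?thesis by (rule that)
qed

text \<open>Right multiplication by an element of \<open>B i b a\<close> fixes zero and carries the
  block into the group \<open>B i a a\<close>, whose closure omits zero.\<close>

lemma closed_block:
  assumes "(i, a, b) \<in> indices"
  shows "closed (B i a b)"
proof -
  have i: "i \<in> I" "a \<in> Lam i" "b \<in> Lam i" using assms by auto
  obtain \<nu> where "pseudocompact_group_with_zero (B i a a) z (idem i a) \<nu>"
    using maximal_subgroup i by blast
  hence zn: "z \<notin> closure (B i a a)" by (rule pseudocompact_group_with_zero.zero_notin_closure)
  obtain y where y: "y \<in> B i b a" using block_nonempty[OF i(1)] by blast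
  have "z \<notin> closure (B i a b)"
  proof
    assume "z \<in> closure (B i a b)"
    hence "z * y \<in> closure (B i a a)"
      by (rule topological_semigroup_mult_closure[OF semigroup, of _ _ _ "{y}"])
         (use i y mult_in_block in auto)
    thus False using zn by simp
  qed
  moreover have "closure (B i a b) \<subseteq> insert z (B i a b)"
    by (rule closure_minimal) (use closed_insert_zero_block[OF assms] in auto)
  ultimately have "closure (B i a b) \<subseteq> B i a b" by auto
  thus ?thesis by (simp add: closure_subset_eq)
qed

section \<open>Neighbourhoods of zero contain almost all blocks\<close>

text \<open>The sets \<open>B i a b - closure W\<close> are locally finite: \<open>W\<close> misses
  them all, and a block, being open, is a neighbourhood meeting at most one.\<close>

lemma finite_blocks_not_in_closure:
  assumes W: "open W" "z \<in> W"
  shows "finite {(i, a, b) \<in> indices. \<not> B i a b \<subseteq> closure W}" (is "finite ?F")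
proof -
  define D where "D = (\<lambda>(i, a, b). B i a b - closure W)"
  have DF: "open (D t)" "D t \<noteq> {}" if "t \<in> ?F" for t
    using that open_block by (auto simp: D_def)
  have uniq: "t = s" if "t \<in> indices" "s \<in> indices" "x \<in> D t" "x \<in> B (fst s) (fst (snd s)) (snd (snd s))" for t s x
    using that block_unique[of _ _ _ _ _ _ x] by (fastforce simp: D_def)
  have "\<exists>N. open N \<and> x \<in> N \<and> finite {A \<in> D ` ?F. A \<inter> N \<noteq> {}}" for x
  proof (cases x rule: block_cases)
    case 1
    have "D t \<inter> W = {}" for t
      using closure_subset[of W] by (auto simp: D_def split: prod.splits)
    hence "{A \<in> D ` ?F. A \<inter> W \<noteq> {}} = {}" by blast
    hence "finite {A \<in> D ` ?F. A \<inter> W \<noteq> {}}" by (simp only: finite.emptyI)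
    thus ?thesis using W 1 by blast
  next
    case (2 j c d)
    have "{A \<in> D ` ?F. A \<inter> B j c d \<noteq> {}} \<subseteq> {D (j, c, d)}"
    proof
      fix A assume "A \<in> {A \<in> D ` ?F. A \<inter> B j c d \<noteq> {}}"
      then obtain t x where t: "t \<in> ?F" "A = D t" "x \<in> D t" "x \<in> B j c d" by blast
      have "t = (j, c, d)" by (rule uniq[of _ _ x]) (use t 2 in auto)
      thus "A \<in> {D (j, c, d)}" using t by simp
    qed
    hence "finite {A \<in> D ` ?F. A \<inter> B j c d \<noteq> {}}" by (rule finite_subset) simp
    thus ?thesis using 2 open_block[of j c d] by blast
  qed
  hence "locally_finite_family (D ` ?F)" unfolding locally_finite_family_def by blast
  moreover have "(\<forall>A\<in>D ` ?F. open A \<and> A \<noteq> {}) \<and> locally_finite_family (D ` ?F) \<longrightarrow> finite (D ` ?F)"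
    using pseudocompact unfolding pseudocompact_def by (rule spec)
  ultimately have "finite (D ` ?F)" using DF by blast
  \<comment> \<open>So far only the set of sets is finite; being disjoint and nonempty, they
    determine their indices.\<close>
  moreover have "inj_on D ?F"
  proof (rule inj_onI)
    fix t s assume ts: "t \<in> ?F" "s \<in> ?F" "D t = D s"
    then obtain x where x: "x \<in> D t" "x \<in> D s" using DF(2)[OF ts(1)] by auto
    show "t = s" by (rule uniq[of t s x]) (use ts x in \<open>auto simp: D_def\<close>)
  qed
  ultimately show ?thesis by (rule finite_imageD)
qed

text \<open>With \<open>v\<close> inverse to \<open>u\<close> in \<open>B i a c\<close> and
  \<open>h * k = idem i a\<close>, one has \<open>x = (h * u) * (v * k * x)\<close>. Density of
  \<open>W\<close> in the two blocks is carried over to the group \<open>B i a a\<close>, where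
  \<open>dense_meets_inverse\<close> provides \<open>h\<close> and \<open>k\<close> with both
  factors in \<open>W\<close>.\<close>

lemma block_subset_of_dense_factors:
  assumes qr: "quasiregular TYPE('a)"
    and W: "open W" "\<And>x y. x \<in> W \<Longrightarrow> y \<in> W \<Longrightarrow> x * y \<in> U"
    and i: "i \<in> I" "a \<in> Lam i" "b \<in> Lam i" "c \<in> Lam i"
    and dense: "B i a c \<subseteq> closure W" "B i c b \<subseteq> closure W"
  shows "B i a b \<subseteq> U"
proof
  fix x assume x: "x \<in> B i a b"
  obtain \<nu> where "pseudocompact_group_with_zero (B i a a) z (idem i a) \<nu>"
    using maximal_subgroup i by blast
  then interpret H: pseudocompact_group_with_zero "B i a a" z "idem i a" \<nu> .
  obtain u where u: "u \<in> B i a c" using block_nonempty[OF i(1)] by blast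
  obtain v where v: "v \<in> B i c a" "u * v = idem i a" "v * u = idem i c"
    using block_inverse[OF i(1,2,4) u] .
  obtain x' where x': "x' \<in> B i b a" "x * x' = idem i a" "x' * x = idem i b"
    using block_inverse[OF i(1,2,3) x] .
  define P where "P = {h \<in> B i a a. h * u \<in> W}"
  define Q where "Q = {k \<in> B i a a. v * k * x \<in> W}"
  have "open ((\<lambda>k. v * k * x) -` W)"
    by (intro open_vimage W topological_semigroup_continuous semigroup continuous_intros)
  moreover have "Q = B i a a \<inter> (\<lambda>k. v * k * x) -` W" by (auto simp: Q_def)
  ultimately have "open Q" using H.open_H by auto
  moreover have "Q \<noteq> {}"
  proof -
    \<comment> \<open>Solving \<open>v * k * x = w\<close> for \<open>k\<close> gives
      \<open>u * w * x'\<close>.\<close>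
    obtain w where w: "w \<in> W" "w \<in> B i c b"
      using block_nonempty[OF i(1), of c b] dense(2) open_disjoint_closure[of "B i c b" _ W]
        open_block[of i c b] i by blast
    have "u * w * x' \<in> B i a a" using mult_in_block i u w x' by meson
    moreover have "v * (u * w * x') * x = (v * u) * w * (x' * x)" by (simp add: mult.assoc)
    hence "v * (u * w * x') * x = w" using v x' w i by simp
    ultimately show ?thesis using w by (auto simp: Q_def)
  qed
  moreover have "Q \<subseteq> B i a a" by (auto simp: Q_def)
  moreover have "D \<inter> P \<noteq> {}" if D: "open D" "D \<noteq> {}" "D \<subseteq> B i a a" for D
  proof -
    \<comment> \<open>\<open>D'\<close> is the translate of \<open>D\<close> by \<open>u\<close>, a
      nonempty open part of \<open>B i a c\<close>, where \<open>W\<close> is dense.\<close>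
    define D' where "D' = B i a c \<inter> (\<lambda>y. y * v) -` D"
    have "open ((\<lambda>y. y * v) -` D)"
      by (intro open_vimage D topological_semigroup_continuous semigroup continuous_intros)
    hence "open D'" using open_block[of i a c] i by (auto simp: D'_def)
    obtain d where d: "d \<in> D" "d \<in> B i a a" using D by blast
    have "d * u \<in> B i a c" using mult_in_block i d u by meson
    hence "d * u \<in> D'" using d v i by (simp add: D'_def mult.assoc)
    then obtain y where y: "y \<in> D'" "y \<in> W"
      using dense(1) \<open>open D'\<close> open_disjoint_closure[of D' "d * u" W] by (auto simp: D'_def)
    have "y * v * u = y" using y v i by (simp add: D'_def mult.assoc)
    hence "y * v \<in> P" "y * v \<in> D" using y D by (auto simp: P_def D'_def)
    thus ?thesis by blast
  qed
  ultimately obtain h k where hk: "h \<in> P" "k \<in> Q" "h * k = idem i a"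
    using H.dense_meets_inverse[OF qr, of Q P] by metis
  have "(h * u) * (v * k * x) \<in> U" using hk W by (auto simp: P_def Q_def)
  moreover have "(h * u) * (v * k * x) = h * ((u * v) * k) * x" by (simp add: mult.assoc)
  moreover have "h * ((u * v) * k) * x = x" using hk v x i by (simp add: Q_def)
  ultimately show "x \<in> U" by simp
qed

text \<open>The middle index \<open>c\<close> is free: for a block not inside \<open>U\<close>,
  every \<open>c\<close> in \<open>Lam i\<close> occurs in a triple of the finite set
  \<open>F\<close> with first entry \<open>i\<close>. Taking \<open>c = a\<close> and
  \<open>c = b\<close> bounds all three indices.\<close>

lemma finite_blocks_not_in_nhd:
  assumes qr: "quasiregular TYPE('a)" and U: "open U" "z \<in> U"
  shows "finite {(i, a, b) \<in> indices. \<not> B i a b \<subseteq> U}" (is "finite ?E")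
proof -
  have "z * z \<in> U" using U by simp
  from topological_semigroup_square_nhd[OF semigroup U(1) this]
  obtain W where W: "open W" "z \<in> W" "\<And>x y. x \<in> W \<Longrightarrow> y \<in> W \<Longrightarrow> x * y \<in> U" by blast
  define F where "F = {(i, a, b) \<in> indices. \<not> B i a b \<subseteq> closure W}"
  have fF: "finite F" unfolding F_def by (rule finite_blocks_not_in_closure[OF W(1,2)])
  define J where "J = fst ` F"
  define L where "L = (fst \<circ> snd) ` F \<union> (snd \<circ> snd) ` F"
  have exc: "(i, a, c) \<in> F \<or> (i, c, b) \<in> F" if "(i, a, b) \<in> ?E" "c \<in> Lam i" for i a b c
    using block_subset_of_dense_factors[OF qr W(1,3), of i a b c] that
    unfolding F_def by auto
  have "?E \<subseteq> J \<times> L \<times> L"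
  proof
    fix t assume "t \<in> ?E"
    then obtain i a b where E: "t = (i, a, b)" "i \<in> I" "a \<in> Lam i" "b \<in> Lam i" "\<not> B i a b \<subseteq> U"
      by blast
    have "i \<in> J \<and> c \<in> L" if "c \<in> Lam i" for c
      using exc[of i a b c] E that unfolding J_def L_def by force
    thus "t \<in> J \<times> L \<times> L" using E by simp
  qed
  moreover have "finite (J \<times> L \<times> L)" using fF by (simp add: J_def L_def)
  ultimately show ?thesis by (rule finite_subset)
qed

end

theorem theorem3p7:
  fixes z :: "'a::{t2_space,semigroup_mult}"
    and I :: "'i set" and Lam :: "'i \<Rightarrow> 'l set"
    and G :: "'i \<Rightarrow> ('g, 'm) monoid_scheme"
    and phi :: "'i \<Rightarrow> 'l \<Rightarrow> 'g \<Rightarrow> 'l \<Rightarrow> 'a"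
  assumes "topological_semigroup TYPE('a)"
    and "quasiregular TYPE('a)"
    and "pseudocompact TYPE('a)"
    and "primitive_inverse_decomp z I Lam G phi"
  shows "base_at
           {UNIV - (\<Union>(i, a, b)\<in>F. block G phi i a b) | F.
              finite F \<and> F \<subseteq> {(i, a, b). i \<in> I \<and> a \<in> Lam i \<and> b \<in> Lam i}}
           z"
proof -
  interpret pseudocompact_primitive_semigroup z I Lam G phi
    using assms by unfold_locales
  show ?thesis
    unfolding base_at_def
  proof (intro conjI ballI allI impI)
    fix A assume "A \<in> {UNIV - (\<Union>(i, a, b)\<in>F. B i a b) | F. finite F \<and> F \<subseteq> indices}"
    then obtain F where F: "A = UNIV - (\<Union>(i, a, b)\<in>F. B i a b)" "finite F" "F \<subseteq> indices"
      by blast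
    have "closed (\<Union>(i, a, b)\<in>F. B i a b)"
      using F closed_block by (intro closed_UN) auto
    thus "open A" by (simp add: F(1) open_Diff)
    show "z \<in> A" using F zero_notin_block by auto
  next
    fix U :: "'a set" assume U: "open U \<and> z \<in> U"
    \<comment> \<open>The removed blocks are exactly those not inside \<open>U\<close>; zero itself
      is in \<open>U\<close>.\<close>
    define F where "F = {(i, a, b) \<in> indices. \<not> B i a b \<subseteq> U}"
    have "finite F" "F \<subseteq> indices"
      using finite_blocks_not_in_nhd[OF assms(2)] U by (auto simp: F_def)
    moreover have "UNIV - (\<Union>(i, a, b)\<in>F. B i a b) \<subseteq> U"
    proof
      fix x assume x: "x \<in> UNIV - (\<Union>(i, a, b)\<in>F. B i a b)"
      show "x \<in> U" by (cases x rule: block_cases) (use x U in \<open>auto simp: F_def\<close>)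
    qed
    ultimately show "\<exists>A\<in>{UNIV - (\<Union>(i, a, b)\<in>F. B i a b) | F. finite F \<and> F \<subseteq> indices}. A \<subseteq> U"
      by blast
  qed
qed

end
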